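(* Let $A=(a_{ij})\in\hat{\mathbb H}^{n\times n}$ be a dual quaternion Hermitian matrix, let $i,j\in\{1,\dots,n\}$ with $i\ne j$, let $\alpha\in\hat{\mathbb H}$, and let $P_{ij;\alpha}$ be the addition matrix. Then $$\mathrm{Cdet}(P_{ij;\alpha}^*AP_{ij;\alpha})=\mathrm{Cdet}(A),$$ where $\mathrm{Cdet}$ is the Chen determinant.
   Context: $\mathbb H$ denotes the real quaternions with conjugation $q\mapsto q^*$. A dual quaternion is $q=q_s+q_d\epsilon$ with $q_s,q_d\in\mathbb H$, where $\epsilon\neq 0$, $\epsilon^2=0$, and $\epsilon$ commutes with all quaternions; the set of dual quaternions is $\hat{\mathbb H}$, and $q^*=q_s^*+q_d^*\epsilon$. For $A=(a_{ij})\in\hat{\mathbb H}^{n\times n}$, $A^*=(a_{ji}^* )$; $A$ is Hermitian if $A^*=A$. Addition matrix: for $i\neq j$, $P_{ij;\alpha}\in\hat{\mathbb H}^{n\times n}$ is the matrix with all diagonal entries equal to $1$, $(j,i)$ entry equal to $\alpha$, and all other entries $0$. Chen determinant: write a permutation $\sigma$ of $\{1,\dots,n\}$ as an ordered product of disjoint cycles (fixed points included) $$\sigma=(n_{11}\cdots n_{1l_1})(n_{21}\cdots n_{2l_2})\cdots(n_{r1}\cdots n_{rl_r}),$$ where $(i_1\cdots i_k)$ means $i_1\mapsto i_2\mapsto\cdots\mapsto i_k\mapsto i_1$, arranged (uniquely) so that $n_{i1}>n_{ij}$ for all $j>1$ and $i=1,\dots,r$, and $n=n_{11}>n_{21}>\cdots>n_{r1}$.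 Set $$a_\sigma=(a_{n_{11}n_{12}}a_{n_{12}n_{13}}\cdots a_{n_{1l_1}n_{11}})(a_{n_{21}n_{22}}\cdots a_{n_{2l_2}n_{21}})\cdots(a_{n_{r1}n_{r2}}\cdots a_{n_{rl_r}n_{r1}})$$ (product in the indicated order). For an arbitrary $A=(a_{ij})\in\hat{\mathbb H}^{n\times n}$, $\mathrm{Cdet}(A)=\sum_\sigma(-1)^{n-r}a_\sigma$, summed over all permutations $\sigma$ of $\{1,\dots,n\}$, where $r$ is the number of cycles of $\sigma$. *)

theory Defs
  imports "Jordan_Normal_Form.Matrix" "HOL-Combinatorics.Cycles"
begin

section \<open>Quaternions\<close>

text \<open>\<open>Quat a b c d\<close> is $a + b\,i + c\,j + d\,k$.\<close>

datatype quat = Quat (qre: real) (qi: real) (qj: real) (qk: real)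

instantiation quat :: ring_1
begin

definition "0 = Quat 0 0 0 0"
definition "1 = Quat 1 0 0 0"
definition "- p = Quat (- qre p) (- qi p) (- qj p) (- qk p)"
definition "p + q = Quat (qre p + qre q) (qi p + qi q) (qj p + qj q) (qk p + qk q)"
definition "p - q = Quat (qre p - qre q) (qi p - qi q) (qj p - qj q) (qk p - qk q)"
definition "p * q = Quat
  (qre p * qre q - qi p * qi q - qj p * qj q - qk p * qk q)
  (qre p * qi q + qi p * qre q + qj p * qk q - qk p * qj q)
  (qre p * qj q - qi p * qk q + qj p * qre q + qk p * qi q)
  (qre p * qk q + qi p * qj q - qj p * qi q + qk p * qre q)"

instance
  by standard
    (simp_all add: zero_quat_def one_quat_def uminus_quat_def plus_quat_def minus_quat_def
      times_quat_def algebra_simps)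

end

definition qcnj :: "quat \<Rightarrow> quat" where
  "qcnj q = Quat (qre q) (- qi q) (- qj q) (- qk q)"

lemma quat_units:
  defines "i \<equiv> Quat 0 1 0 0" and "j \<equiv> Quat 0 0 1 0" and "k \<equiv> Quat 0 0 0 1"
  shows "i * i = - 1" "j * j = - 1" "k * k = - 1" "i * j = k" "j * i = - k"
    "j * k = i" "k * j = - i" "k * i = j" "i * k = - j"
  by (simp_all add: i_def j_def k_def times_quat_def one_quat_def uminus_quat_def)


section \<open>Dual quaternions\<close>

text \<open>\<open>DQuat p q\<close> is $p + q\,\epsilon$.\<close>

datatype dquat = DQuat (std_part: quat) (dual_part: quat)

instantiation dquat :: ring_1
begin

definition "0 = DQuat 0 0"
definition "1 = DQuat 1 0"
definition "- p = DQuat (- std_part p) (- dual_part p)"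
definition "p + q = DQuat (std_part p + std_part q) (dual_part p + dual_part q)"
definition "p - q = DQuat (std_part p - std_part q) (dual_part p - dual_part q)"
definition "p * q = DQuat
  (std_part p * std_part q)
  (std_part p * dual_part q + dual_part p * std_part q)"

instance
  by standard
    (simp_all add: zero_dquat_def one_dquat_def uminus_dquat_def plus_dquat_def minus_dquat_def
      times_dquat_def algebra_simps)

end

definition dqcnj :: "dquat \<Rightarrow> dquat" where
  "dqcnj q = DQuat (qcnj (std_part q)) (qcnj (dual_part q))"

lemma dquat_eps:
  defines "\<epsilon> \<equiv> DQuat 0 1"
  shows "\<epsilon> \<noteq> 0" "\<epsilon> * \<epsilon> = 0" "\<epsilon> * DQuat p 0 = DQuat p 0 * \<epsilon>"
    "DQuat p q = DQuat p 0 + DQuat q 0 * \<epsilon>"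
  by (simp_all add: \<epsilon>_def times_dquat_def plus_dquat_def zero_dquat_def)


section \<open>Dual quaternion matrices\<close>

text \<open>Rows and columns are numbered \<open>0, \<dots>, n - 1\<close> instead of $1, \dots, n$.\<close>

definition conj_transpose :: "dquat mat \<Rightarrow> dquat mat" where
  "conj_transpose A = mat (dim_col A) (dim_row A) (\<lambda>(i, j). dqcnj (A $$ (j, i)))"

definition hermitian :: "dquat mat \<Rightarrow> bool" where
  "hermitian A \<longleftrightarrow> conj_transpose A = A"

text \<open>The entry \<open>\<alpha>\<close> is at position \<open>(j, i)\<close>, not \<open>(i, j)\<close>; only meaningful for \<open>i \<noteq> j\<close>.\<close>

definition addition_mat :: "nat \<Rightarrow> nat \<Rightarrow> nat \<Rightarrow> dquat \<Rightarrow> dquat mat" where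
  "addition_mat n i j \<alpha> =
     mat n n (\<lambda>(k, l). if k = l then 1 else if k = j \<and> l = i then \<alpha> else 0)"


section \<open>The Chen determinant\<close>

text \<open>The largest elements of the cycles of \<open>\<sigma>\<close>.\<close>

definition cycle_maxima :: "nat \<Rightarrow> (nat \<Rightarrow> nat) \<Rightarrow> nat set" where
  "cycle_maxima n \<sigma> = {m. m < n \<and> (\<forall>k. (\<sigma> ^^ k) m \<le> m)}"

text \<open>The normalised cycle decomposition of \<open>\<sigma>\<close>: \<open>support \<sigma> m\<close> is the list
  \<open>[m, \<sigma> m, \<sigma> (\<sigma> m), \<dots>]\<close> running once through the cycle of \<open>m\<close>, fixed points being
  cycles of length one.  Lemma \<open>chen_normal_form_iff\<close> below says that this is the unique
  decomposition with the required normalisation.\<close>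

definition chen_cycles :: "nat \<Rightarrow> (nat \<Rightarrow> nat) \<Rightarrow> nat list list" where
  "chen_cycles n \<sigma> = map (support \<sigma>) (rev (sorted_list_of_set (cycle_maxima n \<sigma>)))"

text \<open>For \<open>c = [i\<^sub>1, \<dots>, i\<^sub>k]\<close> this is $a_{i_1 i_2} a_{i_2 i_3} \cdots a_{i_k i_1}$.\<close>

definition cycle_prod :: "dquat mat \<Rightarrow> nat list \<Rightarrow> dquat" where
  "cycle_prod A c = prod_list (map2 (\<lambda>i j. A $$ (i, j)) c (rotate1 c))"

definition chen_term :: "dquat mat \<Rightarrow> (nat \<Rightarrow> nat) \<Rightarrow> dquat" where
  "chen_term A \<sigma> = prod_list (map (cycle_prod A) (chen_cycles (dim_row A) \<sigma>))"

definition Cdet :: "dquat mat \<Rightarrow> dquat" where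
  "Cdet A = (\<Sum>\<sigma> | \<sigma> permutes {..<dim_row A}.
     (- 1) ^ (dim_row A - length (chen_cycles (dim_row A) \<sigma>)) * chen_term A \<sigma>)"


subsection \<open>The cycle decomposition is the normalised one\<close>

text \<open>\<open>map \<sigma> c = rotate1 c\<close> says that \<open>\<sigma>\<close> maps each entry of \<open>c\<close> to the next one, cyclically.\<close>

definition chen_normal_form :: "nat \<Rightarrow> (nat \<Rightarrow> nat) \<Rightarrow> nat list list \<Rightarrow> bool" where
  "chen_normal_form n \<sigma> cs \<longleftrightarrow>
     (\<forall>c\<in>set cs. c \<noteq> [] \<and> map \<sigma> c = rotate1 c \<and> (\<forall>x\<in>set (tl c). x < hd c)) \<and>
     distinct (concat cs) \<and> set (concat cs) = {..<n} \<and> sorted_wrt (>) (map hd cs)"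

lemma cycle_nth:
  assumes "map \<sigma> c = rotate1 c" "c \<noteq> []"
  shows "(\<sigma> ^^ k) (hd c) = c ! (k mod length c)"
proof (induction k)
  case 0
  then show ?case using assms by (simp add: hd_conv_nth)
next
  case (Suc k)
  have l: "k mod length c < length c" using assms by simp
  have "(\<sigma> ^^ Suc k) (hd c) = map \<sigma> c ! (k mod length c)"
    using Suc l by simp
  also have "\<dots> = c ! (Suc (k mod length c) mod length c)"
    unfolding assms(1) using l by (simp add: nth_rotate1)
  finally show ?case by (simp add: mod_Suc_eq)
qed

lemma cycle_eq_support:
  assumes "map \<sigma> c = rotate1 c" "c \<noteq> []" "distinct c"
  shows "c = support \<sigma> (hd c)"
proof -
  have nth: "(\<sigma> ^^ k) (hd c) = c ! (k mod length c)" for k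
    by (rule cycle_nth[OF assms(1,2)])
  have "least_power \<sigma> (hd c) = length c"
    unfolding least_power_def
  proof (rule Least_equality)
    show "(\<sigma> ^^ length c) (hd c) = hd c \<and> 0 < length c"
      using assms nth[of "length c"] by (simp add: hd_conv_nth)
    fix k assume k: "(\<sigma> ^^ k) (hd c) = hd c \<and> 0 < k"
    show "length c \<le> k"
    proof (rule ccontr)
      assume "\<not> length c \<le> k"
      then have "c ! k = c ! 0" "k < length c" using k nth[of k] assms by (auto simp: hd_conv_nth)
      then show False using k assms by (simp add: nth_eq_iff_index_eq)
    qed
  qed
  then show ?thesis by (intro nth_equalityI) (simp_all add: nth)
qed

lemma funpow_in_support:
  assumes "permutation \<sigma>"
  shows "(\<sigma> ^^ k) x \<in> set (support \<sigma> x)"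
proof -
  have l: "least_power \<sigma> x > 0" "(\<sigma> ^^ least_power \<sigma> x) x = x"
    using least_power_of_permutation[OF assms] by auto
  have "(\<sigma> ^^ k) x = (\<sigma> ^^ (k mod least_power \<sigma> x)) x"
    using l by (simp add: funpow_mod_eq)
  then show ?thesis using l by auto
qed

lemma funpow_back:
  assumes "permutation \<sigma>"
  shows "\<exists>l. (\<sigma> ^^ l) ((\<sigma> ^^ k) x) = x"
proof -
  obtain N where N: "\<sigma> ^^ N = id" "N > 0" using permutation_is_nilpotent[OF assms] by blast
  have "(\<sigma> ^^ (k * N - k)) ((\<sigma> ^^ k) x) = (\<sigma> ^^ (k * N - k + k)) x"
    by (simp only: funpow_add comp_apply)
  also have "k * N - k + k = N * k" using N by (simp add: mult.commute)
  also have "(\<sigma> ^^ (N * k)) x = x" using N by (simp add: funpow_mult[symmetric])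
  finally show ?thesis by blast
qed

lemma distinct_concat_map:
  assumes "distinct xs" "\<And>x. x \<in> set xs \<Longrightarrow> distinct (f x)"
    "\<And>x y. x \<in> set xs \<Longrightarrow> y \<in> set xs \<Longrightarrow> x \<noteq> y \<Longrightarrow> set (f x) \<inter> set (f y) = {}"
  shows "distinct (concat (map f xs))"
  using assms
proof (induction xs)
  case (Cons a xs)
  have "set (f a) \<inter> set (f x) = {}" if "x \<in> set xs" for x
    using Cons.prems(1) that by (intro Cons.prems(3)) auto
  moreover have "distinct (concat (map f xs))"
    using Cons.prems by (intro Cons.IH) auto
  ultimately show ?case using Cons.prems(2)[of a] by auto
qed simp

lemma chen_normal_form_heads:
  assumes "\<sigma> permutes {..<n}" "chen_normal_form n \<sigma> cs"
  shows "set (map hd cs) = cycle_maxima n \<sigma>"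
proof -
  have props: "c \<noteq> []" "map \<sigma> c = rotate1 c" "\<forall>x\<in>set c. x \<le> hd c" "set c \<subseteq> {..<n}"
    if "c \<in> set cs" for c
  proof -
    show 1: "c \<noteq> []" "map \<sigma> c = rotate1 c" and "set c \<subseteq> {..<n}"
      using assms(2) that by (auto simp: chen_normal_form_def)
    have "\<forall>x\<in>set (tl c). x < hd c" using assms(2) that by (auto simp: chen_normal_form_def)
    then show "\<forall>x\<in>set c. x \<le> hd c" using 1 by (cases c) auto
  qed
  show ?thesis
  proof (intro equalityI subsetI)
    fix m assume "m \<in> set (map hd cs)"
    then obtain c where c: "c \<in> set cs" "m = hd c" by auto
    have "(\<sigma> ^^ k) m \<le> m" for k
      using props[OF c(1)] c(2) cycle_nth[of \<sigma> c k] by auto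
    moreover have "m < n" using props[OF c(1)] c(2) hd_in_set[of c] by blast
    ultimately show "m \<in> cycle_maxima n \<sigma>" by (simp add: cycle_maxima_def)
  next
    fix m assume m: "m \<in> cycle_maxima n \<sigma>"
    then have "m \<in> set (concat cs)"
      using assms(2) by (simp add: cycle_maxima_def chen_normal_form_def)
    then obtain c where c: "c \<in> set cs" "m \<in> set c" by auto
    then obtain k where k: "k < length c" "m = c ! k" by (auto simp: in_set_conv_nth)
    then have mk: "m = (\<sigma> ^^ k) (hd c)" using cycle_nth[of \<sigma> c k] props[OF c(1)] by simp
    have "permutation \<sigma>" using assms(1) by (auto simp: permutation_permutes)
    from funpow_back[OF this, of k "hd c"] obtain l where "(\<sigma> ^^ l) m = hd c"
      using mk by auto
    then have "hd c \<le> m" using m unfolding cycle_maxima_def by (metis (mono_tags, lifting) mem_Collect_eq)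
    moreover have "m \<le> hd c" using props[OF c(1)] c by auto
    ultimately show "m \<in> set (map hd cs)" using c by auto
  qed
qed

lemma chen_cycles_normal_form:
  assumes "\<sigma> permutes {..<n}"
  shows "chen_normal_form n \<sigma> (chen_cycles n \<sigma>)"
proof -
  define L where "L = rev (sorted_list_of_set (cycle_maxima n \<sigma>))"
  have perm: "permutation \<sigma>" using assms by (auto simp: permutation_permutes)
  have fin: "finite (cycle_maxima n \<sigma>)" by (simp add: cycle_maxima_def)
  have L: "set L = cycle_maxima n \<sigma>" "distinct L" "sorted_wrt (>) L"
    using fin strict_sorted_list_of_set[of "cycle_maxima n \<sigma>"]
    by (simp_all add: L_def sorted_wrt_rev)
  have lp: "least_power \<sigma> x > 0" "(\<sigma> ^^ least_power \<sigma> x) x = x" for x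
    using least_power_of_permutation[OF perm] by auto
  have dist: "distinct (support \<sigma> x)" for x
    using cycle_of_permutation[OF perm] by simp
  have hd: "hd (support \<sigma> x) = x" for x
    using lp[of x] by (simp add: hd_map)
  have nonempty: "support \<sigma> x \<noteq> []" for x using lp[of x] by simp
  have rot: "map \<sigma> (support \<sigma> x) = rotate1 (support \<sigma> x)" for x
  proof (rule nth_equalityI)
    fix i assume "i < length (map \<sigma> (support \<sigma> x))"
    then have i: "i < least_power \<sigma> x" by simp
    have lhs: "map \<sigma> (support \<sigma> x) ! i = (\<sigma> ^^ Suc i) x" using i by simp
    have rhs: "rotate1 (support \<sigma> x) ! i = (\<sigma> ^^ (Suc i mod least_power \<sigma> x)) x"
      using i by (simp add: nth_rotate1)
    show "map \<sigma> (support \<sigma> x) ! i = rotate1 (support \<sigma> x) ! i"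
      unfolding lhs rhs using lp(2)[of x] by (simp only: funpow_mod_eq)
  qed simp
  have lt: "y < m" if "m \<in> cycle_maxima n \<sigma>" "y \<in> set (tl (support \<sigma> m))" for m y
  proof -
    have "y \<in> set (support \<sigma> m)" by (rule list.set_sel(2)[OF nonempty that(2)])
    then have "y \<le> m" using that(1) by (auto simp: cycle_maxima_def)
    moreover have "y \<noteq> m"
      using dist[of m] that(2) hd[of m] nonempty[of m]
      by (metis distinct.simps(2) list.collapse)
    ultimately show ?thesis by simp
  qed
  have sub: "set (support \<sigma> m) \<subseteq> {..<n}" if "m < n" for m
    using that permutes_in_funpow_image[OF assms, of m] by auto
  have disj: "m = m'"
    if "m \<in> cycle_maxima n \<sigma>" "m' \<in> cycle_maxima n \<sigma>"
      "y \<in> set (support \<sigma> m)" "y \<in> set (support \<sigma> m')" for m m' y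
  proof -
    have *: "m \<le> m'"
      if m': "m' \<in> cycle_maxima n \<sigma>" and y: "y \<in> set (support \<sigma> m)" "y \<in> set (support \<sigma> m')" for m m'
    proof -
      obtain i where i: "y = (\<sigma> ^^ i) m" using y(1) by auto
      obtain i' where i': "y = (\<sigma> ^^ i') m'" using y(2) by auto
      obtain l where "(\<sigma> ^^ l) y = m" using funpow_back[OF perm] i by metis
      then have "(\<sigma> ^^ (l + i')) m' = m" using i' by (simp add: funpow_add)
      then show ?thesis using m' by (auto simp: cycle_maxima_def dest: spec[of _ "l + i'"])
    qed
    show ?thesis using *[of m' m] *[of m m'] that by (meson le_antisym)
  qed
  have cover: "y \<in> (\<Union>m\<in>cycle_maxima n \<sigma>. set (support \<sigma> m))" if "y < n" for y
  proof -
    define m where "m = Max (set (support \<sigma> y))"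
    have "m \<in> set (support \<sigma> y)" unfolding m_def using nonempty[of y] by (intro Max_in) auto
    then obtain i where i: "m = (\<sigma> ^^ i) y" by auto
    have "(\<sigma> ^^ k) m \<le> m" for k
    proof -
      have "(\<sigma> ^^ k) m = (\<sigma> ^^ (k + i)) y" using i by (simp add: funpow_add)
      then have "(\<sigma> ^^ k) m \<in> set (support \<sigma> y)" using funpow_in_support[OF perm] by metis
      then show ?thesis unfolding m_def by (intro Max_ge) auto
    qed
    moreover have "m < n" using \<open>m \<in> _\<close> sub[OF that] by blast
    ultimately have "m \<in> cycle_maxima n \<sigma>" by (simp add: cycle_maxima_def)
    moreover obtain l where "(\<sigma> ^^ l) m = y" using funpow_back[OF perm] i by metis
    then have "y \<in> set (support \<sigma> m)" using funpow_in_support[OF perm] by metis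
    ultimately show ?thesis by blast
  qed
  have cc: "chen_cycles n \<sigma> = map (support \<sigma>) L" by (simp add: chen_cycles_def L_def)
  have heads: "map hd (chen_cycles n \<sigma>) = L"
    unfolding cc map_map by (intro map_idI) (simp only: comp_apply hd)
  have distc: "distinct (concat (map (support \<sigma>) L))"
  proof (rule distinct_concat_map)
    show "set (support \<sigma> x) \<inter> set (support \<sigma> y) = {}"
      if "x \<in> set L" "y \<in> set L" "x \<noteq> y" for x y
      using that disj[of x y] unfolding L(1) by (meson disjoint_iff)
  qed (use L(2) dist in blast)+
  have cov: "set (concat (map (support \<sigma>) L)) = {..<n}"
  proof
    show "set (concat (map (support \<sigma>) L)) \<subseteq> {..<n}"
    proof
      fix y assume "y \<in> set (concat (map (support \<sigma>) L))"
      then obtain m where m: "m \<in> cycle_maxima n \<sigma>" "y \<in> set (support \<sigma> m)" using L(1) by auto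
      then show "y \<in> {..<n}" using sub[of m] by (auto simp: cycle_maxima_def)
    qed
    show "{..<n} \<subseteq> set (concat (map (support \<sigma>) L))"
      using cover L(1) by auto
  qed
  have each: "c \<noteq> [] \<and> map \<sigma> c = rotate1 c \<and> (\<forall>x\<in>set (tl c). x < hd c)"
    if c: "c \<in> set (chen_cycles n \<sigma>)" for c
  proof -
    obtain m where m: "m \<in> cycle_maxima n \<sigma>" "c = support \<sigma> m"
      using c L(1) unfolding cc by auto
    show ?thesis unfolding m(2) hd using nonempty rot lt[OF m(1)] by blast
  qed
  show ?thesis
    unfolding chen_normal_form_def heads
    using each L(3) distc[folded cc] cov[folded cc] by blast
qed

lemma chen_normal_form_iff:
  assumes "\<sigma> permutes {..<n}"
  shows "chen_normal_form n \<sigma> cs \<longleftrightarrow> cs = chen_cycles n \<sigma>"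
proof
  assume nf: "chen_normal_form n \<sigma> cs"
  have "c = support \<sigma> (hd c)" if "c \<in> set cs" for c
    using nf that distinct_concat_iff[of cs]
    by (intro cycle_eq_support) (auto simp: chen_normal_form_def distinct_concat_iff)
  then have "map (support \<sigma>) (map hd cs) = cs"
    unfolding map_map by (intro map_idI) (metis comp_apply)
  moreover have "rev (map hd cs) = sorted_list_of_set (cycle_maxima n \<sigma>)"
  proof -
    have "sorted_wrt (<) (rev (map hd cs))"
      using nf by (simp add: chen_normal_form_def sorted_wrt_rev)
    moreover have "set (rev (map hd cs)) = cycle_maxima n \<sigma>"
      using chen_normal_form_heads[OF assms nf] by simp
    ultimately show ?thesis by (metis sorted_list_of_set.idem_if_sorted_distinct strict_sorted_iff)
  qed
  then have "map hd cs = rev (sorted_list_of_set (cycle_maxima n \<sigma>))"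
    by (metis rev_rev_ident)
  ultimately show "cs = chen_cycles n \<sigma>" by (simp add: chen_cycles_def)
next
  assume "cs = chen_cycles n \<sigma>"
  then show "chen_normal_form n \<sigma> cs" using chen_cycles_normal_form[OF assms] by simp
qed

end

theory Submission
  imports Defs
begin

text \<open>
  Write $\mathrm{Re}\,q = (q + q^*)/2$ for the real part, a dual number.  It is central, and
  $\mathrm{Re}(pq) = \mathrm{Re}(qp)$, so the real part of a cycle product does not depend on
  the vertex at which the cycle is read off.  The proof replaces the Chen determinant by
  $D(M) = \sum_\sigma \mathrm{sgn}(\sigma) \prod_c \mathrm{Re}(m_c)$, the product running over
  the cycles of \<open>\<sigma>\<close> (\<open>re_det\<close>).  For a Hermitian matrix nothing changes: reversing a cycle
  conjugates its product, so in the sum over all permutations every cycle product may be averaged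
  with its conjugate (\<open>sum_paths_conj\<close>, \<open>cycle_sum_hermitian\<close>).  The
  gain is that \<open>D\<close>, even at a matrix that is not Hermitian, can be expanded along the cycle through
  any chosen index, not just the largest one (\<open>re_det_expand\<close>).

  The matrix $P^*AP$ arises from \<open>A\<close> by adding column \<open>j\<close> times \<open>\<alpha>\<close> to column \<open>i\<close>, taking
  the conjugate transpose, and adding column \<open>j\<close> times \<open>\<alpha>\<close> to column \<open>i\<close> again.  The
  intermediate matrices are Hermitian only away from row and column \<open>i\<close>, and this is enough for
  \<open>D\<close>.  Transposition preserves \<open>D\<close>, since it reverses all cycles.  Expansion along \<open>i\<close> shows
  that \<open>D\<close> is additive in column \<open>i\<close>, so a column addition changes \<open>D\<close> by the value of \<open>D\<close>
  at a matrix whose column \<open>i\<close> is column \<open>j\<close> times \<open>\<alpha>\<close>.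

  That value is zero (\<open>re_det_proportional_columns\<close>).  Permutations with \<open>i\<close> and \<open>j\<close> in one
  cycle \<open>(i U j V)\<close> are matched with those having two cycles \<open>(i U)\<close> and \<open>(j V)\<close>.  If \<open>p\<close> is
  the product along the path from \<open>i\<close> through \<open>U\<close> to \<open>j\<close>, and \<open>q\<close> the product along the loop
  from \<open>j\<close> through \<open>V\<close> back to \<open>j\<close>, then the first kind contributes
  $\mathrm{Re}(p q \alpha)$ and the second $\mathrm{Re}(p \alpha)\,\mathrm{Re}(q)$ with the opposite
  sign.  The loop avoids \<open>i\<close>, hence lives in the Hermitian part; averaging over \<open>V\<close> and its reversal
  replaces \<open>q\<close> by $\mathrm{Re}(q)$ in the first expression, and the two cancel.
\<close>

section \<open>Distinct lists over a finite set\<close>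

text \<open>The possible sequences of intermediate vertices on a cycle or path.\<close>

definition paths :: "nat set \<Rightarrow> nat list set" where
  "paths R = {L. distinct L \<and> set L \<subseteq> R}"

lemma finite_paths [simp]: "finite R \<Longrightarrow> finite (paths R)"
  using finite_subset_distinct[of R] by (simp add: paths_def conj_commute)

lemma sum_paths_split:
  fixes f :: "nat list \<Rightarrow> 'a::comm_monoid_add"
  assumes "finite R" "j \<in> R"
  shows "(\<Sum>L\<in>paths R. f L) =
    (\<Sum>U\<in>paths (R - {j}). f U) +
    (\<Sum>U\<in>paths (R - {j}). \<Sum>V\<in>paths (R - {j} - set U). f (U @ j # V))"
proof -
  let ?P = "SIGMA U:paths (R - {j}). paths (R - {j} - set U)"
  have "inj_on (\<lambda>(U, V). U @ j # V) ?P"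
    by (intro inj_onI) (auto simp: paths_def append_eq_append_conv2 append_eq_Cons_conv Cons_eq_append_conv)
  moreover have "(\<lambda>(U, V). U @ j # V) ` ?P = {L \<in> paths R. j \<in> set L}"
  proof (intro equalityI subsetI)
    fix L assume L: "L \<in> {L \<in> paths R. j \<in> set L}"
    then obtain U V where "L = U @ j # V" by (auto simp: in_set_conv_decomp)
    with L show "L \<in> (\<lambda>(U, V). U @ j # V) ` ?P"
      by (intro image_eqI[of _ _ "(U, V)"]) (auto simp: paths_def)
  qed (use assms in \<open>auto simp: paths_def\<close>)
  ultimately have "bij_betw (\<lambda>(U, V). U @ j # V) ?P {L \<in> paths R. j \<in> set L}"
    by (simp add: bij_betw_def)
  from sum.reindex_bij_betw[OF this, of f]
  have "(\<Sum>L | L \<in> paths R \<and> j \<in> set L. f L) = (\<Sum>(U, V)\<in>?P. f (U @ j # V))"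
    by (simp add: case_prod_unfold)
  also have "\<dots> = (\<Sum>U\<in>paths (R - {j}). \<Sum>V\<in>paths (R - {j} - set U). f (U @ j # V))"
    using assms by (intro sum.Sigma[symmetric]) auto
  finally have 1: "(\<Sum>L | L \<in> paths R \<and> j \<in> set L. f L) = \<dots>" .
  have "paths R = paths (R - {j}) \<union> {L \<in> paths R. j \<in> set L}"
    by (auto simp: paths_def)
  then have "(\<Sum>L\<in>paths R. f L) = (\<Sum>L\<in>paths (R - {j}) \<union> {L \<in> paths R. j \<in> set L}. f L)"
    by simp
  also have "\<dots> = (\<Sum>U\<in>paths (R - {j}). f U) + (\<Sum>L | L \<in> paths R \<and> j \<in> set L. f L)"
  proof (rule sum.union_disjoint)
    show "paths (R - {j}) \<inter> {L \<in> paths R. j \<in> set L} = {}" by (auto simp: paths_def)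
  qed (use assms in auto)
  finally show ?thesis using 1 by simp
qed

text \<open>Both sides run over the ordered pairs of disjoint lists.\<close>

lemma sum_paths_swap:
  fixes F :: "nat list \<Rightarrow> nat list \<Rightarrow> 'a::comm_monoid_add"
  assumes "finite T"
  shows "(\<Sum>U\<in>paths T. \<Sum>K\<in>paths (T - set U). F U K) =
    (\<Sum>U\<in>paths T. \<Sum>K\<in>paths (T - set U). F K U)"
proof -
  have *: "(\<Sum>U\<in>paths T. \<Sum>K\<in>paths (T - set U). G U K) =
    (\<Sum>(U, K) | U \<in> paths T \<and> K \<in> paths T \<and> set U \<inter> set K = {}. G U K)"
    for G :: "nat list \<Rightarrow> nat list \<Rightarrow> 'a"
  proof -
    have "(SIGMA U:paths T. paths (T - set U)) =
        {(U, K). U \<in> paths T \<and> K \<in> paths T \<and> set U \<inter> set K = {}}"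
      by (auto simp: paths_def)
    then show ?thesis using assms by (simp add: sum.Sigma)
  qed
  show ?thesis unfolding *
    by (rule sum.reindex_bij_witness[of _ prod.swap prod.swap]) auto
qed

lemma sum_paths_rev: "(\<Sum>L\<in>paths R. f (rev L)) = (\<Sum>L\<in>paths R. f L)"
  by (rule sum.reindex_bij_witness[of _ rev rev]) (auto simp: paths_def)


section \<open>Sums over normalised cycle decompositions\<close>

text \<open>The shape conditions of \<open>chen_normal_form\<close>, detached from a permutation and with an
  arbitrary set in place of an initial segment, so that a cycle can be split off.\<close>

definition normal_cycle_lists :: "nat set \<Rightarrow> nat list list set" where
  "normal_cycle_lists S = {cs. (\<forall>c\<in>set cs. c \<noteq> [] \<and> (\<forall>x\<in>set (tl c). x < hd c)) \<and>
     distinct (concat cs) \<and> set (concat cs) = S \<and> sorted_wrt (>) (map hd cs)}"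

text \<open>With \<open>w c\<close> the product along \<open>c\<close>, and signs included, this is the Chen determinant.
  Leaving \<open>w\<close> open covers the version with real parts as well.\<close>

definition cycle_sum :: "(nat list \<Rightarrow> 'a::ring_1) \<Rightarrow> nat set \<Rightarrow> 'a" where
  "cycle_sum w S = (\<Sum>cs\<in>normal_cycle_lists S. prod_list (map w cs))"

lemma normal_cycle_lists_empty [simp]: "normal_cycle_lists {} = {[]}"
proof -
  have "cs = []" if "cs \<in> normal_cycle_lists {}" for cs
    using that by (cases cs) (auto simp: normal_cycle_lists_def)
  then show ?thesis by (auto simp: normal_cycle_lists_def)
qed

text \<open>Normalisation forces the first cycle to start at the maximum; the remaining entries of that
  cycle are an arbitrary list, and the other cycles form a normalised decomposition of what is
  left.\<close>

lemma normal_cycle_lists_step: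
  assumes "finite S" "S \<noteq> {}"
  defines "m \<equiv> Max S"
  shows "normal_cycle_lists S = (\<lambda>(L, cs). (m # L) # cs) `
    (SIGMA L:paths (S - {m}). normal_cycle_lists (S - {m} - set L))"
proof (intro equalityI subsetI)
  have m: "m \<in> S" "\<And>x. x \<in> S \<Longrightarrow> x \<le> m" using assms by auto
  {
    fix cs assume cs: "cs \<in> normal_cycle_lists S"
    with assms obtain c cs' where [simp]: "cs = c # cs'"
      by (cases cs) (auto simp: normal_cycle_lists_def)
    have c: "c \<noteq> []" "\<forall>x\<in>set (tl c). x < hd c" using cs by (auto simp: normal_cycle_lists_def)
    obtain d where d: "d \<in> set cs" "m \<in> set d" using cs m(1) by (auto simp: normal_cycle_lists_def)
    have dd: "d \<noteq> []" "\<forall>x\<in>set (tl d). x < hd d" "set d \<subseteq> S" "set c \<subseteq> S"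
      using cs d(1) by (auto simp: normal_cycle_lists_def)
    have "hd d \<le> m" using dd m(2) hd_in_set by blast
    moreover have "m \<le> hd d" using d(2) dd by (cases d) auto
    ultimately have hd: "hd d = m" by simp
    have "hd c = m"
    proof (rule ccontr)
      assume "hd c \<noteq> m"
      then have "d \<in> set cs'" using d hd by auto
      then have "hd c > m" using cs hd by (auto simp: normal_cycle_lists_def)
      moreover have "hd c \<le> m" using m(2) dd(4) c(1) hd_in_set by blast
      ultimately show False by simp
    qed
    then obtain L where [simp]: "c = m # L" using c(1) by (cases c) auto
    have "L \<in> paths (S - {m})" "cs' \<in> normal_cycle_lists (S - {m} - set L)"
      using cs by (auto simp: normal_cycle_lists_def paths_def)
    then show "cs \<in> (\<lambda>(L, cs). (m # L) # cs) `
      (SIGMA L:paths (S - {m}). normal_cycle_lists (S - {m} - set L))"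
      by force
  next
    fix cs assume "cs \<in> (\<lambda>(L, cs). (m # L) # cs) `
      (SIGMA L:paths (S - {m}). normal_cycle_lists (S - {m} - set L))"
    then obtain L cs' where [simp]: "cs = (m # L) # cs'" and L: "L \<in> paths (S - {m})"
      and cs': "cs' \<in> normal_cycle_lists (S - {m} - set L)" by auto
    have lt: "x < m" if "x \<in> S - {m}" for x using m(2)[of x] that by auto
    have "hd c \<in> S - {m}" if "c \<in> set cs'" for c
    proof -
      have "c \<noteq> []" "set (concat cs') = S - {m} - set L"
        using that cs' unfolding normal_cycle_lists_def by blast+
      moreover have "hd c \<in> set (concat cs')" using that hd_in_set[OF \<open>c \<noteq> []\<close>] by auto
      ultimately show ?thesis by blast
    qed
    then have "sorted_wrt (>) (map hd cs)"
      using cs' lt by (auto simp: normal_cycle_lists_def)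
    moreover have "distinct (concat cs)" "set (concat cs) = S"
      using L cs' m(1) by (auto simp: normal_cycle_lists_def paths_def)
    moreover have "\<forall>c\<in>set cs. c \<noteq> [] \<and> (\<forall>x\<in>set (tl c). x < hd c)"
      using L cs' lt by (auto simp: normal_cycle_lists_def paths_def)
    ultimately show "cs \<in> normal_cycle_lists S"
      unfolding normal_cycle_lists_def by blast
  }
qed

lemma card_Diff_path_less:
  assumes "finite S" "x \<in> S"
  shows "card (S - {x} - A) < card S"
  by (rule psubset_card_mono) (use assms in blast)+

lemma finite_normal_cycle_lists: "finite S \<Longrightarrow> finite (normal_cycle_lists S)"
proof (induction "card S" arbitrary: S rule: less_induct)
  case less
  show ?case
  proof (cases "S = {}")
    case False
    have "card (S - {Max S} - set L) < card S" for L
      by (intro card_Diff_path_less less.prems Max_in False)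
    then have "finite (normal_cycle_lists (S - {Max S} - set L))" for L
      using less.prems by (intro less.hyps) simp_all
    then show ?thesis
      unfolding normal_cycle_lists_step[OF less.prems False]
      by (intro finite_imageI finite_SigmaI finite_paths finite_Diff less.prems)
  qed simp
qed

lemma cycle_sum_empty [simp]: "cycle_sum w {} = 1"
  by (simp add: cycle_sum_def)

lemma cycle_sum_expand_Max:
  assumes "finite S" "S \<noteq> {}"
  defines "m \<equiv> Max S"
  shows "cycle_sum w S = (\<Sum>L\<in>paths (S - {m}). w (m # L) * cycle_sum w (S - {m} - set L))"
proof -
  have "cycle_sum w S = (\<Sum>(L, cs)\<in>(SIGMA L:paths (S - {m}). normal_cycle_lists (S - {m} - set L)).
      w (m # L) * prod_list (map w cs))"
    unfolding cycle_sum_def normal_cycle_lists_step[OF assms(1,2), folded m_def]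
    by (subst sum.reindex) (auto simp: inj_on_def case_prod_unfold)
  also have "\<dots> = (\<Sum>L\<in>paths (S - {m}). \<Sum>cs\<in>normal_cycle_lists (S - {m} - set L).
      w (m # L) * prod_list (map w cs))"
    using assms by (intro sum.Sigma[symmetric]) (auto intro: finite_normal_cycle_lists)
  finally show ?thesis by (simp add: cycle_sum_def sum_distrib_left)
qed

text \<open>For commuting and rotation-invariant weights the maximum loses its privileged position.
  Expand at the maximum \<open>m\<close>, and distinguish whether \<open>x\<close> lies on the cycle of \<open>m\<close>.  If it does, the
  cycle can be rotated to start at \<open>x\<close>; if not, the induction hypothesis splits off the cycle of
  \<open>x\<close> from the rest, and the two cycles commute.\<close>

lemma cycle_sum_expand:
  assumes "finite S" "x \<in> S"
    and comm: "\<And>c d. w c * w d = w d * w c"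
    and rot: "\<And>x y U V. w (x # U @ y # V) = w (y # V @ x # U)"
  shows "cycle_sum w S = (\<Sum>L\<in>paths (S - {x}). w (x # L) * cycle_sum w (S - {x} - set L))"
  using assms(1,2)
proof (induction "card S" arbitrary: S x rule: less_induct)
  case less
  define m where "m = Max S"
  have m: "m \<in> S" using less.prems unfolding m_def by (intro Max_in) auto
  have expand_m: "cycle_sum w S = (\<Sum>L\<in>paths (S - {m}). w (m # L) * cycle_sum w (S - {m} - set L))"
    unfolding m_def using less.prems by (intro cycle_sum_expand_Max) auto
  show ?case
  proof (cases "x = m")
    case True
    then show ?thesis using expand_m by simp
  next
    case False
    define T where "T = S - {m} - {x}"
    have T: "S - {x} - {m} = T" "S - {m} - {x} = T" "finite T"
      using less.prems by (auto simp: T_def)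
    have IH: "cycle_sum w (S - {a} - set U) =
        (\<Sum>K\<in>paths (T - set U). w (b # K) * cycle_sum w (T - set U - set K))"
      if "U \<in> paths T" "a \<in> S" "b \<in> S" "a \<noteq> b" "S - {a} - {b} = T" for U a b
    proof -
      have "b \<in> S - {a} - set U" using that by (auto simp: paths_def T_def)
      moreover have "card (S - {a} - set U) < card S"
        using that less.prems by (intro card_Diff_path_less)
      moreover have "S - {a} - set U - {b} = T - set U" using that by auto
      ultimately show ?thesis using less(1)[of "S - {a} - set U" b] less.prems by simp
    qed
    \<comment> \<open>Stated for a generic pair, so that it serves both for the expansion at \<open>m\<close> and at \<open>x\<close>.\<close>
    have split: "(\<Sum>L\<in>paths (S - {a}). w (a # L) * cycle_sum w (S - {a} - set L)) =
        (\<Sum>U\<in>paths T. \<Sum>K\<in>paths (T - set U).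
           w (a # U) * (w (b # K) * cycle_sum w (T - set U - set K))) +
        (\<Sum>U\<in>paths T. \<Sum>V\<in>paths (T - set U).
           w (a # U @ b # V) * cycle_sum w (T - set U - set V))"
      if "a \<in> S" "b \<in> S" "a \<noteq> b" "S - {a} - {b} = T" for a b
    proof -
      have "S - {a} - set (U @ b # V) = T - set U - set V" for U V using that by auto
      then show ?thesis
        using that less.prems IH by (subst sum_paths_split[of _ b]) (auto simp: sum_distrib_left)
    qed
    have sets: "T - set U - set V = T - set V - set U" for U V by auto
    have "(\<Sum>U\<in>paths T. \<Sum>K\<in>paths (T - set U).
           w (m # U) * (w (x # K) * cycle_sum w (T - set U - set K))) =
        (\<Sum>U\<in>paths T. \<Sum>K\<in>paths (T - set U).
           w (x # U) * (w (m # K) * cycle_sum w (T - set U - set K)))"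
      using T(3) comm by (subst sum_paths_swap)
        (auto intro!: sum.cong simp: sets simp flip: mult.assoc)
    moreover have "(\<Sum>U\<in>paths T. \<Sum>V\<in>paths (T - set U).
           w (m # U @ x # V) * cycle_sum w (T - set U - set V)) =
        (\<Sum>U\<in>paths T. \<Sum>V\<in>paths (T - set U).
           w (x # U @ m # V) * cycle_sum w (T - set U - set V))"
      using T(3) by (subst sum_paths_swap) (auto intro!: sum.cong simp: sets rot[of m])
    ultimately show ?thesis
      unfolding expand_m using False m less.prems T
      by (simp add: split[of m x] split[of x m])
  qed
qed


section \<open>Conjugation and real part of dual quaternions\<close>

definition dqre :: "dquat \<Rightarrow> dquat" where
  "dqre q = DQuat (Quat (qre (std_part q)) 0 0 0) (Quat (qre (dual_part q)) 0 0 0)"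

lemmas dq_defs = dqre_def dqcnj_def qcnj_def zero_dquat_def one_dquat_def uminus_dquat_def
  plus_dquat_def minus_dquat_def times_dquat_def zero_quat_def one_quat_def uminus_quat_def
  plus_quat_def minus_quat_def times_quat_def

lemma dqcnj_simps [simp]:
  "dqcnj (dqcnj x) = x" "dqcnj (x + y) = dqcnj x + dqcnj y" "dqcnj (- x) = - dqcnj x"
  "dqcnj (x * y) = dqcnj y * dqcnj x" "dqcnj 0 = 0" "dqcnj 1 = 1"
  by (cases x; cases y; simp add: dq_defs algebra_simps)+

lemma dqre_simps [simp]:
  "dqre (x + y) = dqre x + dqre y" "dqre (- x) = - dqre x" "dqre (dqcnj x) = dqre x"
  "dqre 0 = 0" "dqre 1 = 1" "dqre (dqre x) = dqre x"
  by (simp_all add: dq_defs)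

lemma dqre_sum [simp]: "dqre (\<Sum>x\<in>A. f x) = (\<Sum>x\<in>A. dqre (f x))"
  by (induction A rule: infinite_finite_induct) auto

lemma dqre_mult_commute: "dqre (x * y) = dqre (y * x)"
  by (simp add: dq_defs algebra_simps)

lemma dqre_central: "dqre x * y = y * dqre x"
  by (simp add: dq_defs algebra_simps)

lemma dqre_mult_dqre: "dqre (x * dqre y) = dqre x * dqre y"
  by (simp add: dq_defs algebra_simps)

lemma add_dqcnj: "x + dqcnj x = dqre x + dqre x"
  by (simp add: dq_defs)

lemma dquat_double_cancel: "(x::dquat) + x = y + y \<Longrightarrow> x = y"
  by (cases x; cases y) (auto simp: dq_defs intro!: quat.expand)

text \<open>The averaging argument: the sum is unchanged when every list is reversed, so twice the sum is
  the sum of \<open>q L + dqcnj (q L)\<close>, which is twice the real part.\<close>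

lemma sum_paths_conj:
  assumes "\<And>L. L \<in> paths R \<Longrightarrow> q (rev L) = dqcnj (q L)"
    and "\<And>L. L \<in> paths R \<Longrightarrow> h (rev L) = h L"
  shows "(\<Sum>L\<in>paths R. q L * h L) = (\<Sum>L\<in>paths R. dqre (q L) * h L)"
proof (rule dquat_double_cancel)
  have "(\<Sum>L\<in>paths R. q L * h L) + (\<Sum>L\<in>paths R. q L * h L) =
      (\<Sum>L\<in>paths R. q L * h L) + (\<Sum>L\<in>paths R. q (rev L) * h (rev L))"
    by (simp only: sum_paths_rev[of "\<lambda>L. q L * h L"])
  also have "\<dots> = (\<Sum>L\<in>paths R. (q L + dqcnj (q L)) * h L)"
    unfolding sum.distrib[symmetric] using assms by (intro sum.cong) (auto simp: distrib_right)
  also have "\<dots> = (\<Sum>L\<in>paths R. dqre (q L) * h L) + (\<Sum>L\<in>paths R. dqre (q L) * h L)"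
    by (simp add: add_dqcnj distrib_right sum.distrib)
  finally show "(\<Sum>L\<in>paths R. q L * h L) + (\<Sum>L\<in>paths R. q L * h L) = \<dots>" .
qed


section \<open>Signed path products\<close>

text \<open>One sign per intermediate vertex: around a cycle of length $k$ this gives $(-1)^{k-1}$, the
  sign of the cycle.  With signs built in, joining two paths at a vertex costs one
  sign, which is exactly the difference in signature between one merged cycle and two separate
  ones.\<close>

fun path_prod :: "(nat \<Rightarrow> nat \<Rightarrow> dquat) \<Rightarrow> nat \<Rightarrow> nat list \<Rightarrow> nat \<Rightarrow> dquat" where
  "path_prod M a [] b = M a b"
| "path_prod M a (l # L) b = - (M a l * path_prod M l L b)"

lemma path_prod_append:
  "path_prod M a (U @ j # V) b = - (path_prod M a U j * path_prod M j V b)"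
  by (induction U arbitrary: a) (auto simp: mult.assoc)

lemma path_prod_cong:
  assumes "\<And>k l. k \<in> insert a (set L) \<Longrightarrow> l \<in> insert b (set L) \<Longrightarrow> M k l = M' k l"
  shows "path_prod M a L b = path_prod M' a L b"
  using assms
proof (induction L arbitrary: a)
  case (Cons l L)
  have "path_prod M l L b = path_prod M' l L b"
    using Cons.prems by (intro Cons.IH) auto
  then show ?case using Cons.prems[of a l] by simp
qed auto

lemma path_prod_rev:
  "path_prod (\<lambda>k l. dqcnj (M l k)) b (rev L) a = dqcnj (path_prod M a L b)"
  by (induction L arbitrary: a) (auto simp: path_prod_append)

lemma path_prod_rev_hermitian:
  assumes "\<And>k l. k \<in> T \<Longrightarrow> l \<in> T \<Longrightarrow> dqcnj (M l k) = M k l"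
    and "x \<in> T" "set L \<subseteq> T"
  shows "path_prod M x (rev L) x = dqcnj (path_prod M x L x)"
  unfolding path_prod_rev[symmetric] using assms(2,3) by (intro path_prod_cong assms(1)[symmetric]) auto

text \<open>A path that ends at \<open>i\<close> without visiting \<open>i\<close> before uses column \<open>i\<close> for its last entry
  only, so path products are linear in that column.\<close>

lemma path_prod_last_add:
  assumes "i \<notin> set L"
    and "\<And>k l. k \<in> insert a (set L) \<Longrightarrow> l \<in> set L \<Longrightarrow> M' k l = M k l \<and> M'' k l = M k l"
    and "\<And>k. k \<in> insert a (set L) \<Longrightarrow> M k i = M' k i + M'' k i"
  shows "path_prod M a L i = path_prod M' a L i + path_prod M'' a L i"
  using assms
proof (induction L arbitrary: a)
  case (Cons l L)
  have "path_prod M l L i = path_prod M' l L i + path_prod M'' l L i"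
    using Cons.prems by (intro Cons.IH) auto
  moreover have "M' a l = M a l" "M'' a l = M a l" using Cons.prems(2)[of a l] by auto
  ultimately show ?case by (simp add: distrib_left)
qed auto

lemma path_prod_last_mult:
  assumes "\<And>k. k \<in> insert a (set L) \<Longrightarrow> M k i = M k j * \<beta>"
  shows "path_prod M a L i = path_prod M a L j * \<beta>"
  using assms
proof (induction L arbitrary: a)
  case (Cons l L)
  have "path_prod M l L i = path_prod M l L j * \<beta>"
    using Cons.prems by (intro Cons.IH) auto
  then show ?case by (simp add: mult.assoc)
qed auto


section \<open>The determinant with real parts of cycle products\<close>

definition cyc :: "(nat \<Rightarrow> nat \<Rightarrow> dquat) \<Rightarrow> nat list \<Rightarrow> dquat" where
  "cyc M c = path_prod M (hd c) (tl c) (hd c)"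

text \<open>On Hermitian matrices this is the determinant of Moore.\<close>

definition re_det :: "(nat \<Rightarrow> nat \<Rightarrow> dquat) \<Rightarrow> nat set \<Rightarrow> dquat" where
  "re_det M = cycle_sum (\<lambda>c. dqre (cyc M c))"

lemma re_det_expand:
  assumes "finite S" "x \<in> S"
  shows "re_det M S = (\<Sum>L\<in>paths (S - {x}). dqre (path_prod M x L x) * re_det M (S - {x} - set L))"
proof -
  have rot: "dqre (cyc M (x # U @ y # V)) = dqre (cyc M (y # V @ x # U))" for x y U V
    by (simp add: cyc_def path_prod_append dqre_mult_commute[of "path_prod M x U y"])
  show ?thesis
    unfolding re_det_def
    using cycle_sum_expand[where w = "\<lambda>c. dqre (cyc M c)", OF assms dqre_central rot]
    by (simp add: cyc_def)
qed

lemma re_det_empty [simp]: "re_det M {} = 1"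
  by (simp add: re_det_def)

text \<open>The induction that fits an expansion along the cycle of one element; \<open>x\<close> is tied to the
  maximum so that \<open>cycle_sum_expand_Max\<close> remains applicable to noncommuting weights.\<close>

lemma finite_set_expand_induct [consumes 1, case_names empty expand]:
  assumes "finite S" and "P {}"
    and "\<And>S x. finite S \<Longrightarrow> x \<in> S \<Longrightarrow> (\<And>L. P (S - {x} - set L)) \<Longrightarrow> x = Max S \<Longrightarrow> P S"
  shows "P S"
  using assms(1)
proof (induction "card S" arbitrary: S rule: less_induct)
  case less
  show ?case
  proof (cases "S = {}")
    case False
    show ?thesis
    proof (rule assms(3)[of S "Max S"])
      show "P (S - {Max S} - set L)" for L
        by (intro less.hyps card_Diff_path_less finite_Diff less.prems Max_in False)
    qed (use False less.prems in simp_all)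
  qed (use assms in simp)
qed

lemma dqre_re_det: "finite S \<Longrightarrow> dqre (re_det M S) = re_det M S"
proof (induction S rule: finite_set_expand_induct)
  case (expand S x)
  have "dqre (dqre q * re_det M (S - {x} - set L)) = dqre q * re_det M (S - {x} - set L)" for q L
    using dqre_mult_dqre[of "dqre q" "re_det M (S - {x} - set L)"] expand.IH[of L] by simp
  then show ?case by (simp add: re_det_expand[OF expand.hyps(1,2)])
qed simp

lemma re_det_cong:
  assumes "finite S" "\<And>k l. k \<in> S \<Longrightarrow> l \<in> S \<Longrightarrow> M k l = M' k l"
  shows "re_det M S = re_det M' S"
  using assms
proof (induction S rule: finite_set_expand_induct)
  case (expand S x)
  have "re_det M (S - {x} - set L) = re_det M' (S - {x} - set L)" for L
    using expand by auto
  moreover have "path_prod M x L x = path_prod M' x L x" if "L \<in> paths (S - {x})" for L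
    using that expand by (intro path_prod_cong) (auto simp: paths_def)
  ultimately show ?case by (simp add: re_det_expand[OF expand.hyps(1,2)])
qed simp

text \<open>Conjugate transposition reads every cycle backwards and conjugates it, and real parts do not
  see the conjugation.\<close>

lemma re_det_conj_transpose:
  assumes "finite S"
  shows "re_det (\<lambda>k l. dqcnj (M l k)) S = re_det M S"
  using assms
proof (induction S rule: finite_set_expand_induct)
  case (expand S x)
  have "re_det (\<lambda>k l. dqcnj (M l k)) S = (\<Sum>L\<in>paths (S - {x}).
      dqre (path_prod (\<lambda>k l. dqcnj (M l k)) x (rev L) x) * re_det M (S - {x} - set (rev L)))"
    using sum_paths_rev[of "\<lambda>L. dqre (path_prod (\<lambda>k l. dqcnj (M l k)) x L x) *
      re_det M (S - {x} - set L)" "S - {x}"]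
    by (simp add: re_det_expand[OF expand.hyps(1,2)] expand.IH)
  then show ?case by (simp add: re_det_expand[OF expand.hyps(1,2)] path_prod_rev)
qed simp

text \<open>The rest of the expansion depends on the vertex set of the first cycle only, so the averaging
  argument applies to that cycle.  The induction proceeds from the last factor to the first: once
  the remaining cycles carry real parts, the first one can be treated as well.\<close>

lemma cycle_sum_hermitian:
  assumes "finite S" "\<And>k l. k \<in> S \<Longrightarrow> l \<in> S \<Longrightarrow> dqcnj (M l k) = M k l"
  shows "cycle_sum (cyc M) S = re_det M S"
  using assms
proof (induction S rule: finite_set_expand_induct)
  case (expand S x)
  have IH: "cycle_sum (cyc M) (S - {x} - set L) = re_det M (S - {x} - set L)" for L
    using expand by auto
  have "cycle_sum (cyc M) S =
      (\<Sum>L\<in>paths (S - {x}). path_prod M x L x * re_det M (S - {x} - set L))"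
  proof -
    have "cyc M (x # L) = path_prod M x L x" for L by (simp add: cyc_def)
    moreover have "S \<noteq> {}" "Max S = x" using expand.hyps by auto
    ultimately show ?thesis
      using cycle_sum_expand_Max[of S "cyc M"] expand.hyps(1) IH by simp
  qed
  also have "\<dots> = (\<Sum>L\<in>paths (S - {x}). dqre (path_prod M x L x) * re_det M (S - {x} - set L))"
    using expand by (intro sum_paths_conj path_prod_rev_hermitian[of S]) (auto simp: paths_def)
  finally show ?case by (simp add: re_det_expand[OF expand.hyps(1,2)])
qed (simp add: re_det_def)


section \<open>Column operations\<close>

text \<open>Merging or splitting the cycles at \<open>i\<close> and \<open>j\<close> changes the sign.  In a commutative ring
  this alone gives cancellation; here the loop at \<open>j\<close> must first be replaced by its real part,
  for which Hermitian symmetry away from \<open>i\<close> is what is required.\<close>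

lemma re_det_proportional_columns:
  assumes S: "finite S" "i \<in> S" "j \<in> S" "i \<noteq> j"
    and herm: "\<And>k l. k \<in> S - {i} \<Longrightarrow> l \<in> S - {i} \<Longrightarrow> dqcnj (M l k) = M k l"
    and col: "\<And>k. k \<in> S \<Longrightarrow> M k i = M k j * \<beta>"
  shows "re_det M S = 0"
proof -
  define T where "T = S - {i} - {j}"
  define p where "p U = path_prod M i U j" for U
  define q where "q V = path_prod M j V j" for V
  define D where "D U V = re_det M (T - set U - set V)" for U V
  have T: "finite T" using S by (simp add: T_def)
  have pp: "path_prod M i L i = path_prod M i L j * \<beta>" if "set L \<subseteq> S" for L
    using that S by (intro path_prod_last_mult col) auto
  have outer: "re_det M (S - {i} - set U) = (\<Sum>V\<in>paths (T - set U). dqre (q V) * D U V)"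
    if "U \<in> paths T" for U
  proof -
    have "S - {i} - set U - {j} = T - set U" by (auto simp: T_def)
    then show ?thesis
      using that S by (subst re_det_expand[of _ j]) (auto simp: D_def q_def paths_def T_def)
  qed
  \<comment> \<open>Summing over \<open>V\<close> with \<open>U\<close> fixed turns the terms with \<open>i\<close> and \<open>j\<close> on a common cycle into
    the negative of the term with \<open>j\<close> on a separate cycle.\<close>
  have inner: "(\<Sum>V\<in>paths (T - set U). dqre (path_prod M i (U @ j # V) i) *
        re_det M (S - {i} - set (U @ j # V))) =
      - (dqre (p U * \<beta>) * re_det M (S - {i} - set U))" if U: "U \<in> paths T" for U
  proof -
    \<comment> \<open>The remaining determinants are real, so they move in and out of \<open>dqre\<close> freely; moving them
      in leaves the sum over \<open>V\<close> between the fixed factors \<open>p U\<close> and \<open>\<beta>\<close>.\<close>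
    have D: "dqre (D U V) = D U V" for V using T by (simp add: D_def dqre_re_det)
    have "dqre (path_prod M i (U @ j # V) i) * re_det M (S - {i} - set (U @ j # V)) =
        - dqre (p U * (q V * D U V) * \<beta>)" if "V \<in> paths (T - set U)" for V
    proof -
      have "set (U @ j # V) \<subseteq> S" using that U S by (auto simp: paths_def T_def)
      then have "path_prod M i (U @ j # V) i = - (p U * q V * \<beta>)"
        by (subst pp) (simp_all add: path_prod_append p_def q_def)
      moreover have "S - {i} - set (U @ j # V) = T - set U - set V" by (auto simp: T_def)
      moreover have "dqre (p U * q V * \<beta>) * D U V = dqre (p U * (q V * D U V) * \<beta>)"
        using dqre_mult_dqre[of "p U * q V * \<beta>" "D U V"] dqre_central[of "D U V" \<beta>] D
        by (simp add: mult.assoc)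
      ultimately show ?thesis by (simp add: D_def)
    qed
    then have "(\<Sum>V\<in>paths (T - set U). dqre (path_prod M i (U @ j # V) i) *
        re_det M (S - {i} - set (U @ j # V))) =
        - dqre (p U * (\<Sum>V\<in>paths (T - set U). q V * D U V) * \<beta>)"
      by (simp add: sum_negf sum_distrib_left sum_distrib_right)
    also have "(\<Sum>V\<in>paths (T - set U). q V * D U V) =
        (\<Sum>V\<in>paths (T - set U). dqre (q V) * D U V)"
      unfolding q_def using S
      by (intro sum_paths_conj path_prod_rev_hermitian[of "S - {i}"] herm)
        (auto simp: D_def paths_def T_def)
    also have "\<dots> = re_det M (S - {i} - set U)" using outer[OF U] by simp
    also have "dqre (p U * re_det M (S - {i} - set U) * \<beta>) =
        dqre (p U * \<beta>) * re_det M (S - {i} - set U)"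
      using dqre_mult_dqre[of "p U * \<beta>" "re_det M (S - {i} - set U)"]
        dqre_central[of "re_det M (S - {i} - set U)" \<beta>] dqre_re_det[of "S - {i} - set U" M] S
      by (simp add: mult.assoc)
    finally show ?thesis .
  qed
  have "re_det M S = (\<Sum>U\<in>paths T. dqre (path_prod M i U i) * re_det M (S - {i} - set U)) +
      (\<Sum>U\<in>paths T. - (dqre (p U * \<beta>) * re_det M (S - {i} - set U)))"
    using S inner
    by (subst re_det_expand[of S i], simp_all, subst sum_paths_split[of _ j])
      (auto simp: T_def)
  also have "(\<Sum>U\<in>paths T. dqre (path_prod M i U i) * re_det M (S - {i} - set U)) =
      (\<Sum>U\<in>paths T. dqre (p U * \<beta>) * re_det M (S - {i} - set U))"
  proof (intro sum.cong refl)
    fix U assume "U \<in> paths T"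
    then have "set U \<subseteq> S" by (auto simp: paths_def T_def)
    then show "dqre (path_prod M i U i) * re_det M (S - {i} - set U) =
        dqre (p U * \<beta>) * re_det M (S - {i} - set U)" by (simp add: pp p_def)
  qed
  finally show ?thesis by (simp add: sum_negf)
qed

lemma re_det_column_add:
  assumes "finite S" "i \<in> S"
    and "\<And>k l. k \<in> S \<Longrightarrow> l \<in> S \<Longrightarrow> l \<noteq> i \<Longrightarrow> M' k l = M k l \<and> M'' k l = M k l"
    and "\<And>k. k \<in> S \<Longrightarrow> M k i = M' k i + M'' k i"
  shows "re_det M S = re_det M' S + re_det M'' S"
proof -
  have D: "re_det M (S - {i} - set L) = re_det M' (S - {i} - set L)"
    "re_det M (S - {i} - set L) = re_det M'' (S - {i} - set L)" for L
    using assms(1) by (intro re_det_cong; simp add: assms(3))+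
  have "path_prod M i L i = path_prod M' i L i + path_prod M'' i L i"
    if "L \<in> paths (S - {i})" for L
    using that assms(2-4) by (intro path_prod_last_add) (auto simp: paths_def)
  then have "re_det M S = (\<Sum>L\<in>paths (S - {i}).
      dqre (path_prod M' i L i) * re_det M (S - {i} - set L) +
      dqre (path_prod M'' i L i) * re_det M (S - {i} - set L))"
    by (simp add: re_det_expand[OF assms(1,2)] distrib_right)
  also have "\<dots> = re_det M' S + re_det M'' S"
    unfolding sum.distrib by (simp only: re_det_expand[OF assms(1,2), of M']
      re_det_expand[OF assms(1,2), of M''] flip: D)
  finally show ?thesis .
qed

definition add_column :: "nat \<Rightarrow> nat \<Rightarrow> dquat \<Rightarrow> (nat \<Rightarrow> nat \<Rightarrow> dquat) \<Rightarrow> nat \<Rightarrow> nat \<Rightarrow> dquat" where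
  "add_column i j \<alpha> M k l = (if l = i then M k i + M k j * \<alpha> else M k l)"

text \<open>Hermitian symmetry is assumed only off \<open>i\<close>, because the second of two successive column
  additions is applied to a matrix whose row \<open>i\<close> has already changed.\<close>

lemma re_det_add_column:
  assumes "finite S" "i \<in> S" "j \<in> S" "i \<noteq> j"
    and "\<And>k l. k \<in> S - {i} \<Longrightarrow> l \<in> S - {i} \<Longrightarrow> dqcnj (M l k) = M k l"
  shows "re_det (add_column i j \<alpha> M) S = re_det M S"
proof -
  let ?N = "\<lambda>k l. if l = i then M k j * \<alpha> else M k l"
  have "re_det (add_column i j \<alpha> M) S = re_det M S + re_det ?N S"
    using assms by (intro re_det_column_add) (auto simp: add_column_def)
  also have "re_det ?N S = 0"
    using assms by (intro re_det_proportional_columns[of S i j _ \<alpha>]) auto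
  finally show ?thesis by simp
qed


section \<open>The Chen determinant as a sum over cycle decompositions\<close>

lemma chen_normal_form_alt:
  "chen_normal_form n \<sigma> cs \<longleftrightarrow>
    cs \<in> normal_cycle_lists {..<n} \<and> (\<forall>c\<in>set cs. map \<sigma> c = rotate1 c)"
  by (auto simp: chen_normal_form_def normal_cycle_lists_def)

text \<open>A permutation is determined by the successor relation of its cycles.  Conversely, a
  normalised list of cycles yields one: it sends each entry of the concatenation to the entry at
  the same position after every cycle has been rotated by one.\<close>

lemma bij_betw_chen_cycles:
  "bij_betw (chen_cycles n) {\<sigma>. \<sigma> permutes {..<n}} (normal_cycle_lists {..<n})"
proof (rule bij_betwI')
  fix \<sigma> \<tau> assume \<sigma>: "\<sigma> \<in> {\<sigma>. \<sigma> permutes {..<n}}" and \<tau>: "\<tau> \<in> {\<sigma>. \<sigma> permutes {..<n}}"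
  have nf: "chen_normal_form n \<sigma> (chen_cycles n \<sigma>)" "chen_normal_form n \<tau> (chen_cycles n \<tau>)"
    using \<sigma> \<tau> chen_cycles_normal_form by auto
  show "chen_cycles n \<sigma> = chen_cycles n \<tau> \<longleftrightarrow> \<sigma> = \<tau>"
  proof
    assume eq: "chen_cycles n \<sigma> = chen_cycles n \<tau>"
    have "\<sigma> x = \<tau> x" for x
    proof (cases "x < n")
      case True
      then have "x \<in> set (concat (chen_cycles n \<sigma>))"
        using nf(1) by (simp add: chen_normal_form_def)
      then obtain c where c: "c \<in> set (chen_cycles n \<sigma>)" "x \<in> set c" by auto
      then have "map \<sigma> c = map \<tau> c" using nf eq by (auto simp: chen_normal_form_alt)
      then show ?thesis using c(2) by simp
    next
      case False
      then show ?thesis using \<sigma> \<tau> by (auto simp: permutes_def)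
    qed
    then show "\<sigma> = \<tau>" by blast
  qed simp
next
  fix \<sigma> assume "\<sigma> \<in> {\<sigma>. \<sigma> permutes {..<n}}"
  then show "chen_cycles n \<sigma> \<in> normal_cycle_lists {..<n}"
    using chen_cycles_normal_form by (auto simp: chen_normal_form_alt)
next
  fix cs assume cs: "cs \<in> normal_cycle_lists {..<n}"
  define xs where "xs = concat cs"
  define ys where "ys = concat (map rotate1 cs)"
  define \<sigma> where "\<sigma> x = (case map_of (zip xs ys) x of Some y \<Rightarrow> y | None \<Rightarrow> x)" for x
  have mset: "mset ys = mset xs"
  proof -
    have "mset (rotate1 c) = mset c" for c :: "nat list" by (cases c) auto
    then show ?thesis unfolding xs_def ys_def by (induction cs) auto
  qed
  have len: "length xs = length ys" using mset by (metis size_mset)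
  have xs: "distinct xs" "set xs = {..<n}" using cs by (auto simp: normal_cycle_lists_def xs_def)
  have ys: "distinct ys" "set ys = {..<n}"
    using xs mset by (metis mset_eq_imp_distinct_iff, metis mset_eq_setD)
  have map: "map \<sigma> xs = ys"
    by (rule nth_equalityI)
      (use len xs in \<open>auto simp: \<sigma>_def map_of_zip_nth[OF len xs(1)] split: option.splits\<close>)
  have "map_of (zip xs ys) x = None" if "x \<notin> {..<n}" for x
    using that xs len by (simp add: map_of_zip_is_None)
  then have out: "\<sigma> x = x" if "x \<notin> {..<n}" for x using that by (simp add: \<sigma>_def)
  have "bij_betw \<sigma> {..<n} {..<n}"
  proof (rule bij_betw_imageI)
    have "distinct (map \<sigma> xs)" by (simp only: map ys(1))
    then show "inj_on \<sigma> {..<n}" by (simp only: distinct_map xs(2))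
    have "\<sigma> ` set xs = set ys" by (simp only: map flip: set_map)
    then show "\<sigma> ` {..<n} = {..<n}" by (simp only: xs(2) ys(2))
  qed
  then have perm: "\<sigma> permutes {..<n}" using out by (intro bij_imp_permutes) auto
  have "map \<sigma> c = rotate1 c" if "c \<in> set cs" for c
    using map that unfolding xs_def ys_def
    by (induction cs) auto
  then have "chen_normal_form n \<sigma> cs" using cs by (simp add: chen_normal_form_alt)
  then show "\<exists>\<sigma>\<in>{\<sigma>. \<sigma> permutes {..<n}}. cs = chen_cycles n \<sigma>"
    using perm chen_normal_form_iff by blast
qed

lemma path_prod_eq_cycle_prod:
  "path_prod (\<lambda>k l. A $$ (k, l)) a L b =
    (- 1) ^ length L * prod_list (map2 (\<lambda>i j. A $$ (i, j)) (a # L) (L @ [b]))"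
  by (induction L arbitrary: a) (auto simp: minus_one_power_iff)

lemma cyc_eq_cycle_prod:
  "c \<noteq> [] \<Longrightarrow> cyc (\<lambda>k l. A $$ (k, l)) c = (- 1) ^ (length c - 1) * cycle_prod A c"
  by (cases c) (auto simp: cyc_def cycle_prod_def path_prod_eq_cycle_prod)

text \<open>The signs $(-1)^{l-1}$ of the cycles multiply to $(-1)^{n-r}$.\<close>

lemma prod_list_cyc:
  assumes "\<forall>c\<in>set cs. c \<noteq> []"
  shows "prod_list (map (cyc (\<lambda>k l. A $$ (k, l))) cs) =
    (- 1) ^ (length (concat cs) - length cs) * prod_list (map (cycle_prod A) cs)"
proof -
  have "prod_list (map (cyc (\<lambda>k l. A $$ (k, l))) cs) =
      (- 1) ^ (length (concat cs) - length cs) * prod_list (map (cycle_prod A) cs) \<and>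
      length cs \<le> length (concat cs)"
    using assms
  proof (induction cs)
    case (Cons c cs)
    have "length c \<ge> 1" using Cons.prems by (cases c) auto
    then have len: "length (concat (c # cs)) - length (c # cs) =
        (length c - 1) + (length (concat cs) - length cs)" "length (c # cs) \<le> length (concat (c # cs))"
      using Cons by auto
    have sign: "((- 1) ^ a * p) * ((- 1) ^ b * q) = (- 1) ^ (a + b) * (p * q)"
      for a b and p q :: dquat
      by (cases "even a"; cases "even b") simp_all
    have "prod_list (map (cyc (\<lambda>k l. A $$ (k, l))) cs) =
        (- 1) ^ (length (concat cs) - length cs) * prod_list (map (cycle_prod A) cs)"
      using Cons by simp
    then show ?case
      unfolding len(1) using Cons.prems len(2)
      by (simp only: list.map prod_list.Cons cyc_eq_cycle_prod sign list.set_intros simp_thms)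
  qed simp
  then show ?thesis by blast
qed

lemma Cdet_eq_cycle_sum:
  assumes "A \<in> carrier_mat n n"
  shows "Cdet A = cycle_sum (cyc (\<lambda>k l. A $$ (k, l))) {..<n}"
proof -
  have "Cdet A = (\<Sum>cs\<in>normal_cycle_lists {..<n}.
      (- 1) ^ (n - length cs) * prod_list (map (cycle_prod A) cs))"
    using assms sum.reindex_bij_betw[OF bij_betw_chen_cycles[of n],
        of "\<lambda>cs. (- 1) ^ (n - length cs) * prod_list (map (cycle_prod A) cs)"]
    by (simp add: Cdet_def chen_term_def)
  also have "\<dots> = cycle_sum (cyc (\<lambda>k l. A $$ (k, l))) {..<n}"
    unfolding cycle_sum_def
  proof (intro sum.cong refl)
    fix cs assume "cs \<in> normal_cycle_lists {..<n}"
    then have "\<forall>c\<in>set cs. c \<noteq> []" "length (concat cs) = n"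
      using distinct_card[of "concat cs"] by (auto simp: normal_cycle_lists_def)
    then show "(- 1) ^ (n - length cs) * prod_list (map (cycle_prod A) cs) =
        prod_list (map (cyc (\<lambda>k l. A $$ (k, l))) cs)"
      by (simp add: prod_list_cyc)
  qed
  finally show ?thesis .
qed

lemma Cdet_hermitian:
  assumes "A \<in> carrier_mat n n" "\<And>k l. k < n \<Longrightarrow> l < n \<Longrightarrow> dqcnj (A $$ (l, k)) = A $$ (k, l)"
  shows "Cdet A = re_det (\<lambda>k l. A $$ (k, l)) {..<n}"
  unfolding Cdet_eq_cycle_sum[OF assms(1)] using assms(2) by (intro cycle_sum_hermitian) auto


section \<open>Invariance under congruence by an addition matrix\<close>

lemma mult_addition_mat_index:
  assumes "M \<in> carrier_mat n n" "i < n" "j < n" "i \<noteq> j" "k < n" "l < n"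
  shows "(M * addition_mat n i j \<alpha>) $$ (k, l) = add_column i j \<alpha> (\<lambda>k l. M $$ (k, l)) k l"
proof -
  have "(M * addition_mat n i j \<alpha>) $$ (k, l) =
      (\<Sum>s<n. M $$ (k, s) * (if s = l then 1 else if s = j \<and> l = i then \<alpha> else 0))"
    using assms by (auto simp: addition_mat_def scalar_prod_def atLeast0LessThan)
  also have "\<dots> = (\<Sum>s<n. (if s = l then M $$ (k, s) else 0) +
      (if s = j then if l = i then M $$ (k, s) * \<alpha> else 0 else 0))"
    using assms by (intro sum.cong) auto
  also have "\<dots> = add_column i j \<alpha> (\<lambda>k l. M $$ (k, l)) k l"
    unfolding sum.distrib using assms by (auto simp: add_column_def)
  finally show ?thesis .
qed

lemma dqcnj_sum [simp]: "dqcnj (\<Sum>x\<in>A. f x) = (\<Sum>x\<in>A. dqcnj (f x))"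
  by (induction A rule: infinite_finite_induct) auto

lemma conj_transpose_mult:
  assumes "A \<in> carrier_mat n m" "B \<in> carrier_mat m p"
  shows "conj_transpose (A * B) = conj_transpose B * conj_transpose A"
  using assms by (intro eq_matI) (auto simp: conj_transpose_def scalar_prod_def)

lemma conj_transpose_carrier [simp]:
  "A \<in> carrier_mat n m \<Longrightarrow> conj_transpose A \<in> carrier_mat m n"
  by (auto simp: conj_transpose_def)

lemma conj_transpose_conj_transpose [simp]: "conj_transpose (conj_transpose A) = A"
  by (intro eq_matI) (auto simp: conj_transpose_def)

lemma conj_transpose_index:
  "A \<in> carrier_mat n m \<Longrightarrow> k < m \<Longrightarrow> l < n \<Longrightarrow> conj_transpose A $$ (k, l) = dqcnj (A $$ (l, k))"
  by (auto simp: conj_transpose_def)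

lemma hermitian_index:
  assumes "A \<in> carrier_mat n n" "hermitian A" "k < n" "l < n"
  shows "dqcnj (A $$ (l, k)) = A $$ (k, l)"
  using conj_transpose_index[OF assms(1,3,4)] assms(2) by (simp add: hermitian_def)

theorem lemma3p6:
  fixes A :: "dquat mat" and n i j :: nat and \<alpha> :: dquat
  assumes "A \<in> carrier_mat n n" and "hermitian A"
    and "i < n" and "j < n" and "i \<noteq> j"
  shows "Cdet (conj_transpose (addition_mat n i j \<alpha>) * A * addition_mat n i j \<alpha>) = Cdet A"
proof -
  let ?P = "addition_mat n i j \<alpha>"
  let ?B = "conj_transpose ?P * A * ?P"
  let ?a = "\<lambda>k l. A $$ (k, l)"
  let ?c = "add_column i j \<alpha> ?a"
  \<comment> \<open>\<open>?c\<close> and \<open>?r\<close> have the entries of \<open>A * ?P\<close> and of its conjugate transpose, which is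
    \<open>conj_transpose ?P * A\<close>.\<close>
  let ?r = "\<lambda>k l. dqcnj (?c l k)"
  have P: "?P \<in> carrier_mat n n" by (simp add: addition_mat_def)
  have a: "dqcnj (?a l k) = ?a k l" if "k < n" "l < n" for k l
    using hermitian_index[OF assms(1,2) that] .
  have row: "conj_transpose ?P * A = conj_transpose (A * ?P)"
    using assms(1,2) P by (simp add: conj_transpose_mult hermitian_def)
  have B: "?B \<in> carrier_mat n n" using assms(1) P by (meson conj_transpose_carrier mult_carrier_mat)
  have "hermitian ?B"
    using assms(1,2) P
    by (simp add: hermitian_def conj_transpose_mult[of _ n n _ n] assoc_mult_mat[of _ n n _ n _ n])
  then have "Cdet ?B = re_det (\<lambda>k l. ?B $$ (k, l)) {..<n}"
    using B by (intro Cdet_hermitian hermitian_index)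
  also have "\<dots> = re_det (add_column i j \<alpha> ?r) {..<n}"
  proof (rule re_det_cong)
    have AP: "A * ?P \<in> carrier_mat n n" using assms(1) P by simp
    have r: "conj_transpose (A * ?P) $$ (k, l) = ?r k l" if "k < n" "l < n" for k l
      using that assms by (simp add: conj_transpose_index[OF AP] mult_addition_mat_index)
    fix k l assume kl: "k \<in> {..<n}" "l \<in> {..<n}"
    then have "?B $$ (k, l) = add_column i j \<alpha> (\<lambda>k l. conj_transpose (A * ?P) $$ (k, l)) k l"
      unfolding row using assms AP by (intro mult_addition_mat_index) auto
    also have "\<dots> = add_column i j \<alpha> ?r k l"
      using kl r assms by (simp add: add_column_def[of _ _ _ _ k l])
    finally show "?B $$ (k, l) = add_column i j \<alpha> ?r k l" .
  qed simp
  also have "\<dots> = re_det ?r {..<n}"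
    using assms a by (intro re_det_add_column) (auto simp: add_column_def)
  also have "\<dots> = re_det ?c {..<n}" by (intro re_det_conj_transpose) simp
  also have "\<dots> = re_det ?a {..<n}"
    using assms a by (intro re_det_add_column) auto
  also have "\<dots> = Cdet A" using assms(1) a by (intro Cdet_hermitian[symmetric])
  finally show ?thesis .
qed

end
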